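(* Let $\mathcal{H}$ be a complex Hilbert space and let $(\mathtt{V},U)$ be a regular pair on $\mathcal{H}$. Then the multiplicity space of $(\mathcal{H},\mathtt{V},U)$ is isomorphic to $\mathbb{R}$ if and only if $U$ is $\mathbb{R}$-cyclic.
   Context: All Hilbert spaces are separable. $\mathbb{C}_+=\{z\in\mathbb{C}:\operatorname{Im} z>0\}$. A standard subspace of $\mathcal{H}$ is a closed real subspace $\mathtt{V}$ with $\mathtt{V}\cap i\mathtt{V}=\{0\}$ and $\overline{\mathtt{V}+i\mathtt{V}}=\mathcal{H}$. A regular pair on $\mathcal{H}$ is a pair $(\mathtt{V},U)$ of a standard subspace $\mathtt{V}\subseteq\mathcal{H}$ and a strongly continuous unitary one-parameter group $U:\mathbb{R}\to\mathrm{U}(\mathcal{H})$ such that $(\mathcal{H},\mathtt{V},U)$ is a real regular one-parameter group (with $\mathcal{H}$ regarded as a real Hilbert space with scalar product $\operatorname{Re}\langle\cdot,\cdot\rangle$), i.e. $U_t\mathtt{V}\subseteq\mathtt{V}$ for $t\ge0$, $\bigcap_{t\in\mathbb{R}}U_t\mathtt{V}=\{0\}$ and $\overline{\bigcup_{t\in\mathbb{R}}U_t\mathtt{V}}=\mathcal{H}$. For a real Hilbert space $\mathcal{K}$ with complexification $\mathcal{K}_{\mathbb{C}}$ and conjugation $\mathcal{C}_{\mathcal{K}}$, put $f^\sharp(x)=\mathcal{C}_{\mathcal{K}}f(-x)$ for $f\in L^2(\mathbb{R},\mathcal{K}_{\mathbb{C}})$; superscript $\sharp$ denotes the real subspace of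 $\sharp$-fixed elements. $H^2(\mathbb{C}_+,\mathcal{K}_{\mathbb{C}})\subseteq L^2(\mathbb{R},\mathcal{K}_{\mathbb{C}})$ is the Hardy space (boundary values of holomorphic $f:\mathbb{C}_+\to\mathcal{K}_{\mathbb{C}}$ with $\sup_{y>0}\int_{\mathbb{R}}\|f(x+iy)\|^2dx<\infty$), and $(S_tf)(x)=e^{itx}f(x)$. By the Lax--Phillips theorem, for every real regular one-parameter group $(\mathcal{E},\mathcal{E}_+,U)$ there is a real Hilbert space $\mathcal{K}$, unique up to isomorphism and called its multiplicity space, for which there is a (real) unitary $\psi:\mathcal{E}\to L^2(\mathbb{R},\mathcal{K}_{\mathbb{C}})^\sharp$ with $\psi(\mathcal{E}_+)=H^2(\mathbb{C}_+,\mathcal{K}_{\mathbb{C}})^\sharp$ and $\psi U_t=S_t\psi$ for all $t$. $U$ is $\mathbb{R}$-cyclic if there is $v\in\mathcal{H}$ with $\overline{\operatorname{span}_{\mathbb{R}}\{U_tv:t\in\mathbb{R}\}}=\mathcal{H}$.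
   Formalization: The Hilbert space H is assumed to be nonzero; for H = {0} the trivial group U is ℝ-cyclic while the multiplicity space is {0}, so the claim fails in that single case. *)

theory Defs
  imports "HOL-Analysis.Analysis"
begin

section \<open>Complex Hilbert spaces\<close>

text \<open>
  A complex inner product space is a type that also carries its underlying real structure:
  the real scalar product (hence the norm and the topology) is the real part of the complex one,
  so positive definiteness is inherited from \<^class>\<open>real_inner\<close>.
  A separable complex Hilbert space is a type of sort
  \<open>{complex_inner, polish_space}\<close>, and a separable real Hilbert space is one of sort
  \<open>{real_inner, polish_space}\<close>.
\<close>

class complex_inner = real_inner +
  fixes scaleC :: "complex \<Rightarrow> 'a \<Rightarrow> 'a"  (infixr "*\<^sub>C" 75)
    and cinner :: "'a \<Rightarrow> 'a \<Rightarrow> complex"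
  assumes scaleC_add_right: "a *\<^sub>C (x + y) = a *\<^sub>C x + a *\<^sub>C y"
    and scaleC_add_left: "(a + b) *\<^sub>C x = a *\<^sub>C x + b *\<^sub>C x"
    and scaleC_scaleC: "a *\<^sub>C (b *\<^sub>C x) = (a * b) *\<^sub>C x"
    and scaleC_of_real: "complex_of_real r *\<^sub>C x = r *\<^sub>R x"
    and cinner_commute: "cinner x y = cnj (cinner y x)"
    and cinner_add_right: "cinner x (y + z) = cinner x y + cinner x z"
    and cinner_scaleC_right: "cinner x (a *\<^sub>C y) = a * cinner x y"
    and inner_eq_Re_cinner: "inner x y = Re (cinner x y)"


section \<open>Real regular one-parameter groups and regular pairs\<close>

definition real_unitary :: "('a::real_inner \<Rightarrow> 'b::real_inner) \<Rightarrow> bool" where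
  "real_unitary T \<longleftrightarrow> linear T \<and> surj T \<and> (\<forall>x y. inner (T x) (T y) = inner x y)"

definition complex_unitary :: "('a::complex_inner \<Rightarrow> 'b::complex_inner) \<Rightarrow> bool" where
  "complex_unitary T \<longleftrightarrow>
     (\<forall>x y. T (x + y) = T x + T y) \<and> (\<forall>a x. T (a *\<^sub>C x) = a *\<^sub>C T x) \<and>
     surj T \<and> (\<forall>x y. cinner (T x) (T y) = cinner x y)"

definition isomorphic_real_hilbert :: "'a::real_inner itself \<Rightarrow> 'b::real_inner itself \<Rightarrow> bool" where
  "isomorphic_real_hilbert _ _ \<longleftrightarrow> (\<exists>T :: 'a \<Rightarrow> 'b. real_unitary T)"

definition strongly_continuous_group :: "(real \<Rightarrow> 'e::real_normed_vector \<Rightarrow> 'e) \<Rightarrow> bool" where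
  "strongly_continuous_group U \<longleftrightarrow>
     U 0 = id \<and> (\<forall>s t. U (s + t) = U s \<circ> U t) \<and> (\<forall>v. continuous_on UNIV (\<lambda>t. U t v))"

definition real_regular_group :: "'e::real_inner set \<Rightarrow> (real \<Rightarrow> 'e \<Rightarrow> 'e) \<Rightarrow> bool" where
  "real_regular_group E U \<longleftrightarrow>
     subspace E \<and> closed E \<and>
     strongly_continuous_group U \<and> (\<forall>t. real_unitary (U t)) \<and>
     (\<forall>t\<ge>0. U t ` E \<subseteq> E) \<and>
     (\<Inter>t. U t ` E) = {0} \<and>
     closure (\<Union>t. U t ` E) = UNIV"

definition standard_subspace :: "'h::complex_inner set \<Rightarrow> bool" where
  "standard_subspace V \<longleftrightarrow>
     subspace V \<and> closed V \<and>
     V \<inter> (\<lambda>v. \<i> *\<^sub>C v) ` V = {0} \<and>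
     closure {v + \<i> *\<^sub>C w | v w. v \<in> V \<and> w \<in> V} = UNIV"

definition regular_pair :: "'h::complex_inner set \<Rightarrow> (real \<Rightarrow> 'h \<Rightarrow> 'h) \<Rightarrow> bool" where
  "regular_pair V U \<longleftrightarrow>
     standard_subspace V \<and>
     strongly_continuous_group U \<and> (\<forall>t. complex_unitary (U t)) \<and>
     real_regular_group V U"

definition R_cyclic :: "(real \<Rightarrow> 'e::real_normed_vector \<Rightarrow> 'e) \<Rightarrow> bool" where
  "R_cyclic U \<longleftrightarrow> (\<exists>v. closure (span (range (\<lambda>t. U t v))) = UNIV)"


section \<open>Complexification\<close>

text \<open>
  The pair \<open>(a, b)\<close> stands for \<open>a + \<i> b\<close>. The product inner product on
  \<open>'k \<times> 'k\<close> is the real part of the complexified scalar product, so the norm is the right one.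
\<close>

type_synonym 'k complexification = "'k \<times> 'k"

definition cscale :: "complex \<Rightarrow> 'k::real_vector complexification \<Rightarrow> 'k complexification" where
  "cscale c z = (Re c *\<^sub>R fst z - Im c *\<^sub>R snd z, Im c *\<^sub>R fst z + Re c *\<^sub>R snd z)"

definition cconj :: "'k::real_vector complexification \<Rightarrow> 'k complexification" where
  "cconj z = (fst z, - snd z)"


section \<open>The spaces \<open>L\<^sup>2\<close> and \<open>H\<^sup>2\<close>\<close>

text \<open>
  Elements of \<open>L\<^sup>2(\<real>, K\<^sub>\<complex>)\<close> are handled through Borel representatives; the sets below are
  closed under almost everywhere equality of Borel functions.
\<close>

definition L2 :: "(real \<Rightarrow> 'k::{real_inner,polish_space} complexification) set" where
  "L2 = {f \<in> borel_measurable borel. integrable lborel (\<lambda>x. (norm (f x))\<^sup>2)}"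

definition sharp :: "(real \<Rightarrow> 'k::real_vector complexification) \<Rightarrow> real \<Rightarrow> 'k complexification" where
  "sharp f = (\<lambda>x. cconj (f (- x)))"

definition sharp_fixed ::
  "(real \<Rightarrow> 'k::real_vector complexification) set \<Rightarrow> (real \<Rightarrow> 'k complexification) set" where
  "sharp_fixed A = {f \<in> A. AE x in lborel. sharp f x = f x}"

definition upper_half_plane :: "complex set" where
  "upper_half_plane = {z. Im z > 0}"

definition vec_holomorphic_on ::
  "(complex \<Rightarrow> 'k::real_inner complexification) \<Rightarrow> complex set \<Rightarrow> bool" where
  "vec_holomorphic_on F S \<longleftrightarrow>
     (\<forall>z\<in>S. \<exists>d. (F has_derivative (\<lambda>h. cscale h d)) (at z within S))"

definition hardy :: "(real \<Rightarrow> 'k::{real_inner,polish_space} complexification) set" where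
  "hardy = {f \<in> L2. \<exists>F. vec_holomorphic_on F upper_half_plane \<and>
     (SUP y\<in>{0<..}. \<integral>\<^sup>+x. ennreal ((norm (F (Complex x y)))\<^sup>2) \<partial>lborel) < \<infinity> \<and>
     (AE x in lborel. ((\<lambda>y. F (Complex x y)) \<longlongrightarrow> f x) (at_right 0))}"


section \<open>Multiplicity spaces\<close>

text \<open>All Borel representatives of the classes of \<open>\<psi> v\<close>, \<open>v \<in> A\<close>.\<close>

definition class_image ::
  "('e \<Rightarrow> real \<Rightarrow> 'b::topological_space) \<Rightarrow> 'e set \<Rightarrow> (real \<Rightarrow> 'b) set" where
  "class_image \<psi> A = {f \<in> borel_measurable borel. \<exists>v\<in>A. AE x in lborel. f x = \<psi> v x}"

text \<open>
  \<open>\<psi>\<close> induces a real unitary from \<open>'e\<close> onto \<open>L\<^sup>2(\<real>, K\<^sub>\<complex>)\<^sup>\<sharp>\<close>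
  that maps \<open>E\<close> onto \<open>H\<^sup>2(\<complex>\<^sub>+, K\<^sub>\<complex>)\<^sup>\<sharp>\<close> and intertwines \<open>U\<close> with
  multiplication by \<open>e\<^bsup>itx\<^esup>\<close>.
\<close>

definition lax_phillips_map ::
  "('e::real_inner \<Rightarrow> real \<Rightarrow> 'k::{real_inner,polish_space} complexification) \<Rightarrow>
     'e set \<Rightarrow> (real \<Rightarrow> 'e \<Rightarrow> 'e) \<Rightarrow> bool" where
  "lax_phillips_map \<psi> E U \<longleftrightarrow>
     (\<forall>v. \<psi> v \<in> L2) \<and>
     (\<forall>v w. AE x in lborel. \<psi> (v + w) x = \<psi> v x + \<psi> w x) \<and>
     (\<forall>r v. AE x in lborel. \<psi> (r *\<^sub>R v) x = r *\<^sub>R \<psi> v x) \<and>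
     (\<forall>v w. (LINT x|lborel. inner (\<psi> v x) (\<psi> w x)) = inner v w) \<and>
     class_image \<psi> UNIV = sharp_fixed L2 \<and>
     class_image \<psi> E = sharp_fixed hardy \<and>
     (\<forall>t v. AE x in lborel. \<psi> (U t v) x = cscale (cis (t * x)) (\<psi> v x))"

definition multiplicity_space ::
  "'k::{real_inner,polish_space} itself \<Rightarrow> 'e::real_inner set \<Rightarrow> (real \<Rightarrow> 'e \<Rightarrow> 'e) \<Rightarrow> bool" where
  "multiplicity_space _ E U \<longleftrightarrow>
     (\<exists>\<psi> :: 'e \<Rightarrow> real \<Rightarrow> 'k complexification. lax_phillips_map \<psi> E U)"

end

theory Submission
  imports Defs "HOL-Probability.Levy"
begin

text \<open>Only the underlying real one-parameter group matters. If the multiplicity space is the real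
  line, a Gaussian is cyclic in the \<open>\<sharp>\<close>-fixed part of \<open>L\<^sup>2\<close>: if \<open>g\<close> is orthogonal to its orbit,
  the Fourier transform of \<open>g\<close> times the Gaussian vanishes. If the multiplicity space contains
  orthonormal vectors \<open>e1\<close>, \<open>e2\<close>, no \<open>f\<close> is cyclic: a pointwise quarter turn of the \<open>e1\<close>, \<open>e2\<close>
  coordinates of \<open>f\<close>, combined with complex conjugation, gives a \<open>\<sharp>\<close>-fixed function orthogonal to
  the orbit of \<open>f\<close>. It is nonzero unless \<open>f\<close> has no \<open>e1\<close>, \<open>e2\<close> components, and then a Gaussian
  multiple of \<open>e1\<close> is orthogonal to the orbit.\<close>

section \<open>Orthogonality and density in Hilbert spaces\<close>

text \<open>A minimising sequence is Cauchy by the parallelogram law, because midpoints stay in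
  \<open>W\<close>; completeness gives a limit, which closedness keeps in \<open>W\<close>.\<close>

lemma closed_subspace_nearest_point:
  fixes W :: "'a::{real_inner,complete_space} set"
  assumes W: "subspace W" "closed W"
  obtains w where "w \<in> W" "\<And>y. y \<in> W \<Longrightarrow> norm (x - w) \<le> norm (x - y)"
proof -
  define d where "d = infdist x W"
  have ne: "W \<noteq> {}" using W(1) subspace_0 by auto
  have d0: "0 \<le> d" by (simp add: d_def infdist_nonneg)
  have d_le: "d \<le> norm (x - y)" if "y \<in> W" for y
    using infdist_le[OF that, of x] by (simp add: d_def dist_norm)
  have "\<exists>w\<in>W. norm (x - w) < d + inverse (real (Suc n))" for n
  proof (rule ccontr)
    assume "\<not> ?thesis"
    then have "d + inverse (real (Suc n)) \<le> dist x w" if "w \<in> W" for w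
      using that by (force simp: dist_norm)
    then have "d + inverse (real (Suc n)) \<le> infdist x W"
      unfolding infdist_notempty[OF ne] by (intro cINF_greatest ne) auto
    then show False by (simp add: d_def)
  qed
  then obtain X where X: "\<And>n. X n \<in> W" "\<And>n. norm (x - X n) < d + inverse (real (Suc n))"
    by metis
  \<comment> \<open>With \<open>e = 1/(k+1)\<close>, the parallelogram identity for
    \<open>x - X m\<close> and \<open>x - X n\<close> bounds the left side by
    \<open>4 * ((d + e)^2 - d^2)\<close>, since the midpoint is at distance at least
    \<open>d\<close> from \<open>x\<close>. As \<open>e \<le> 1\<close>, this is at most linear in
    \<open>e\<close>.\<close>
  have sq: "(norm (X m - X n))\<^sup>2 \<le> 4 * (2 * d + 1) * inverse (real (Suc k))"
    if "k \<le> m" "k \<le> n" for k m n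
  proof -
    define e where "e = inverse (real (Suc k))"
    have e: "0 < e" "e \<le> 1" by (auto simp: e_def field_simps)
    have *: "(norm (x - X j))\<^sup>2 \<le> (d + e)\<^sup>2" if "k \<le> j" for j
    proof (rule power_mono)
      have "inverse (real (Suc j)) \<le> e" unfolding e_def using that by (simp add: field_simps)
      then show "norm (x - X j) \<le> d + e" using X(2)[of j] by simp
    qed simp
    have "(1/2) *\<^sub>R (X m + X n) \<in> W"
      using X(1) W(1) by (intro subspace_scale subspace_add)
    from power_mono[OF d_le[OF this] d0, of 2]
    have mid: "d\<^sup>2 \<le> (norm (x - (1/2) *\<^sub>R (X m + X n)))\<^sup>2" .
    have "(norm (X m - X n))\<^sup>2 = 2 * (norm (x - X m))\<^sup>2 + 2 * (norm (x - X n))\<^sup>2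
        - 4 * (norm (x - (1/2) *\<^sub>R (X m + X n)))\<^sup>2"
      unfolding power2_norm_eq_inner by (simp add: algebra_simps inner_commute)
    also have "\<dots> \<le> 4 * (d + e)\<^sup>2 - 4 * d\<^sup>2"
      using *[OF that(1)] *[OF that(2)] mid by linarith
    also have "\<dots> = 4 * (2 * d + e) * e" by (simp add: power2_eq_square algebra_simps)
    also have "\<dots> \<le> 4 * (2 * d + 1) * e" using e by (intro mult_right_mono) auto
    finally show ?thesis by (simp add: e_def)
  qed
  have "Cauchy X"
  proof (rule metric_CauchyI)
    fix r :: real assume r: "0 < r"
    have "0 < r\<^sup>2 / (4 * (2 * d + 1))" using r d0 by simp
    then obtain k where k: "inverse (real (Suc k)) < r\<^sup>2 / (4 * (2 * d + 1))"
      using reals_Archimedean by blast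
    have "dist (X m) (X n) < r" if "k \<le> m" "k \<le> n" for m n
    proof -
      have "4 * (2 * d + 1) * inverse (real (Suc k)) < r\<^sup>2"
        using k d0 by (simp add: field_simps)
      then have "(norm (X m - X n))\<^sup>2 < r\<^sup>2" using sq[OF that] by linarith
      then show ?thesis using r by (simp add: dist_norm power_less_imp_less_base)
    qed
    then show "\<exists>M. \<forall>m\<ge>M. \<forall>n\<ge>M. dist (X m) (X n) < r" by blast
  qed
  then obtain w where lim: "X \<longlonglongrightarrow> w" by (metis Cauchy_convergent convergent_def)
  have "w \<in> W" using closed_sequentially[OF W(2)] X(1) lim by blast
  moreover have "norm (x - w) \<le> d"
  proof (rule LIMSEQ_le)
    show "(\<lambda>n. norm (x - X n)) \<longlonglongrightarrow> norm (x - w)" by (intro tendsto_intros lim)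
    show "(\<lambda>n. d + inverse (real (Suc n))) \<longlonglongrightarrow> d"
      using tendsto_add[OF tendsto_const LIMSEQ_inverse_real_of_nat, of d] by simp
    show "\<exists>N. \<forall>n\<ge>N. norm (x - X n) \<le> d + inverse (real (Suc n))"
      using X(2) less_imp_le by blast
  qed
  ultimately show ?thesis using that d_le by fastforce
qed

text \<open>Moving from \<open>w\<close> along \<open>y\<close> cannot bring the point closer to
  \<open>x\<close>; the best step length makes this \<open>2 * a^2 \<le> a^2\<close> for
  \<open>a = inner y (x - w)\<close>.\<close>

lemma nearest_point_orthogonal:
  fixes W :: "'a::real_inner set"
  assumes W: "subspace W" "w \<in> W" "\<And>y. y \<in> W \<Longrightarrow> norm (x - w) \<le> norm (x - y)" and y: "y \<in> W"
  shows "inner y (x - w) = 0"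
proof (cases "y = 0")
  case False
  \<comment> \<open>The minimiser of the quadratic polynomial
    \<open>t \<mapsto> norm ((x - w) - t *\<^sub>R y)^2\<close>.\<close>
  define t where "t = inner y (x - w) / inner y y"
  have yy: "0 < inner y y" using False by simp
  have "w + t *\<^sub>R y \<in> W" using W y by (intro subspace_add subspace_scale)
  from W(3)[OF this] have "(norm (x - w))\<^sup>2 \<le> (norm ((x - w) - t *\<^sub>R y))\<^sup>2"
    by (intro power_mono) (auto simp: algebra_simps)
  then have "2 * t * inner y (x - w) \<le> t * t * inner y y"
    unfolding power2_norm_eq_inner by (simp add: inner_diff_left inner_diff_right inner_commute algebra_simps)
  then have "2 * (inner y (x - w))\<^sup>2 \<le> (inner y (x - w))\<^sup>2"
    using yy by (simp add: t_def power2_eq_square field_simps)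
  then show ?thesis by simp
qed simp

lemma orthogonal_closure_span:
  fixes S :: "'a::real_inner set"
  assumes "\<And>s. s \<in> S \<Longrightarrow> inner s w = 0" and "x \<in> closure (span S)"
  shows "inner x w = 0"
proof -
  have "span S \<subseteq> {y. inner y w = 0}"
    using assms(1) by (intro span_minimal) (auto simp: subspace_def inner_add_left)
  moreover have "closed {y. inner y w = 0}"
    by (intro closed_Collect_eq continuous_intros)
  ultimately show ?thesis using closure_minimal assms(2) by blast
qed

lemma subspace_closure:
  fixes S :: "'a::real_normed_vector set"
  assumes S: "subspace S"
  shows "subspace (closure S)"
proof (rule subspaceI)
  show "0 \<in> closure S" using subspace_0[OF S] closure_subset by blast
  show "x + y \<in> closure S" if "x \<in> closure S" "y \<in> closure S" for x y
  proof -
    obtain X Y where "\<And>n. X n \<in> S" "X \<longlonglongrightarrow> x" "\<And>n. Y n \<in> S" "Y \<longlonglongrightarrow> y"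
      using \<open>x \<in> closure S\<close> \<open>y \<in> closure S\<close> unfolding closure_sequential by blast
    then have "\<forall>n. X n + Y n \<in> S" "(\<lambda>n. X n + Y n) \<longlonglongrightarrow> x + y"
      using subspace_add[OF S] by (auto intro: tendsto_add)
    then show ?thesis
      unfolding closure_sequential by (intro exI[of _ "\<lambda>n. X n + Y n"] conjI)
  qed
  show "c *\<^sub>R x \<in> closure S" if "x \<in> closure S" for c x
  proof -
    obtain X where "\<And>n. X n \<in> S" "X \<longlonglongrightarrow> x"
      using \<open>x \<in> closure S\<close> unfolding closure_sequential by blast
    then have "\<forall>n. c *\<^sub>R X n \<in> S" "(\<lambda>n. c *\<^sub>R X n) \<longlonglongrightarrow> c *\<^sub>R x"
      using subspace_scale[OF S] by (auto intro: tendsto_intros)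
    then show ?thesis
      unfolding closure_sequential by (intro exI[of _ "\<lambda>n. c *\<^sub>R X n"] conjI)
  qed
qed

text \<open>The form in which cyclicity is used in both directions. For density, the difference of
  \<open>x\<close> and its nearest point in the closed span is orthogonal to \<open>S\<close>, hence
  zero.\<close>

lemma closure_span_eq_UNIV_iff:
  fixes S :: "'a::{real_inner,complete_space} set"
  shows "closure (span S) = UNIV \<longleftrightarrow> (\<forall>w. (\<forall>s\<in>S. inner s w = 0) \<longrightarrow> w = 0)"
proof
  assume L: "closure (span S) = UNIV"
  show "\<forall>w. (\<forall>s\<in>S. inner s w = 0) \<longrightarrow> w = 0"
    using orthogonal_closure_span[of S _ _] L by (metis UNIV_I inner_eq_zero_iff)
next
  assume R: "\<forall>w. (\<forall>s\<in>S. inner s w = 0) \<longrightarrow> w = 0"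
  have "x \<in> closure (span S)" for x
  proof -
    have sub: "subspace (closure (span S))" by (intro subspace_closure subspace_span)
    obtain w where w: "w \<in> closure (span S)"
        "\<And>y. y \<in> closure (span S) \<Longrightarrow> norm (x - w) \<le> norm (x - y)"
      using closed_subspace_nearest_point[OF sub closed_closure] by metis
    have "inner s (x - w) = 0" if "s \<in> S" for s
      using nearest_point_orthogonal[OF sub w] that
      by (meson closure_subset in_mono span_base)
    then have "x - w = 0" using R by blast
    then show ?thesis using w(1) by simp
  qed
  then show "closure (span S) = UNIV" by blast
qed


section \<open>Injectivity of the Fourier transform on integrable functions\<close>

lemma char_density:
  fixes f :: "real \<Rightarrow> real"
  assumes "f \<in> borel_measurable borel" "\<And>x. 0 \<le> f x"
  shows "char (density lborel f) t = (CLINT x|lborel. f x *\<^sub>R iexp (t * x))"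
  unfolding char_def using assms by (subst integral_density) auto

lemma real_distribution_density:
  fixes f :: "real \<Rightarrow> real"
  assumes "integrable lborel f" "\<And>x. 0 \<le> f x" "integral\<^sup>L lborel f = 1"
  shows "real_distribution (density lborel f)"
proof -
  have "prob_space (density lborel f)"
    using assms by (intro prob_spaceI) (simp add: emeasure_density nn_integral_eq_integral)
  then show ?thesis by (simp add: real_distribution_def real_distribution_axioms_def)
qed

lemma integrable_bounded_mult:
  fixes c h :: "real \<Rightarrow> real"
  assumes "integrable lborel h" "c \<in> borel_measurable borel" "\<And>x. \<bar>c x\<bar> \<le> 1"
  shows "integrable lborel (\<lambda>x. c x * h x)"
  using assms(1)
proof (rule Bochner_Integration.integrable_bound)
  show "AE x in lborel. norm (c x * h x) \<le> norm (h x)"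
    using assms(3) by (auto simp: abs_mult mult_left_le_one_le)
qed (use assms(1,2) in auto)

text \<open>The positive and negative parts, normalised to probability densities, have the same
  characteristic function.\<close>

lemma fourier_injective:
  fixes h :: "real \<Rightarrow> real"
  assumes h: "integrable lborel h"
    and cs: "\<And>t. (LINT x|lborel. cos (t * x) * h x) = 0"
    and sn: "\<And>t. (LINT x|lborel. sin (t * x) * h x) = 0"
  shows "AE x in lborel. h x = 0"
proof -
  define p where "p = (\<lambda>x. max 0 (h x))"
  define q where "q = (\<lambda>x. max 0 (- h x))"
  have pq: "h x = p x - q x" "0 \<le> p x" "0 \<le> q x" for x by (auto simp: p_def q_def)
  have int: "integrable lborel p" "integrable lborel q"
    using h by (auto simp: p_def q_def)
  have [measurable]: "p \<in> borel_measurable borel" "q \<in> borel_measurable borel"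
    using int by auto
  define c where "c = integral\<^sup>L lborel p"
  have "integral\<^sup>L lborel h = integral\<^sup>L lborel p - integral\<^sup>L lborel q"
    unfolding pq(1)[abs_def] using int by (rule Bochner_Integration.integral_diff)
  \<comment> \<open>At \<open>t = 0\<close> the cosine hypothesis says that \<open>h\<close> has
    integral zero, so both parts have the same mass \<open>c\<close>.\<close>
  with cs[of 0] have cq: "integral\<^sup>L lborel q = c" by (simp add: c_def)
  have c0: "0 \<le> c" using pq by (simp add: c_def)
  show ?thesis
  proof (cases "c = 0")
    \<comment> \<open>Normalising by \<open>c\<close> is impossible here, but nonnegative functions
      of mass zero vanish almost everywhere.\<close>
    case True
    have "AE x in lborel. p x = 0" "AE x in lborel. q x = 0"
      using integral_nonneg_eq_0_iff_AE[OF int(1)] integral_nonneg_eq_0_iff_AE[OF int(2)] True cq pq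
      by (auto simp: c_def)
    then show ?thesis by eventually_elim (simp add: pq)
  next
    case False
    with c0 have c: "0 < c" by simp
    have "char (density lborel (\<lambda>x. p x / c)) = char (density lborel (\<lambda>x. q x / c))"
    proof
      fix t
      have i: "integrable lborel (\<lambda>x. f x *\<^sub>R iexp (t * x))" if "integrable lborel f" for f
        using that
        by (rule Bochner_Integration.integrable_bound) (use that in \<open>auto simp: norm_mult\<close>)
      \<comment> \<open>The hypotheses are the real and imaginary parts of the Fourier transform of
        \<open>h\<close>, up to the factor \<open>c\<close>; its vanishing equates the transforms of
        \<open>p / c\<close> and \<open>q / c\<close>.\<close>
      let ?D = "CLINT x|lborel. (h x / c) *\<^sub>R iexp (t * x)"
      have hc: "integrable lborel (\<lambda>x. h x / c)" using h by simp
      have "Re ?D = (LINT x|lborel. (cos (t * x) * h x) / c)"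
        by (subst integral_Re[OF i[OF hc], symmetric]) (simp add: Re_exp mult.commute)
      moreover have "Im ?D = (LINT x|lborel. (sin (t * x) * h x) / c)"
        by (subst integral_Im[OF i[OF hc], symmetric]) (simp add: Im_exp mult.commute)
      ultimately have "?D = 0" using cs sn by (simp add: complex_eq_iff)
      moreover have "?D = (CLINT x|lborel. (p x / c) *\<^sub>R iexp (t * x))
          - (CLINT x|lborel. (q x / c) *\<^sub>R iexp (t * x))"
        using i[of "\<lambda>x. p x / c"] i[of "\<lambda>x. q x / c"] int
        by (simp add: pq(1) diff_divide_distrib scaleR_diff_left)
      ultimately show "char (density lborel (\<lambda>x. p x / c)) t = char (density lborel (\<lambda>x. q x / c)) t"
        using c pq by (simp add: char_density)
    qed
    moreover have "real_distribution (density lborel (\<lambda>x. p x / c))"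
        "real_distribution (density lborel (\<lambda>x. q x / c))"
      using int pq c cq by (auto intro!: real_distribution_density simp: c_def[symmetric])
    ultimately have "density lborel (\<lambda>x. p x / c) = density lborel (\<lambda>x. q x / c)"
      by (intro Levy_uniqueness)
    then have "AE x in lborel. ennreal (p x / c) = ennreal (q x / c)"
      by (intro sigma_finite_measure.density_unique[OF lborel.sigma_finite_measure_axioms]) auto
    then show ?thesis by eventually_elim (use pq c in auto)
  qed
qed

text \<open>Reflection preserves Lebesgue measure, so the integral equals its own negative. A
  non-integrable \<open>f\<close> fits in, its integral being 0 by convention.\<close>

lemma integral_odd:
  fixes f :: "real \<Rightarrow> real"
  assumes f: "f \<in> borel_measurable borel" and odd: "AE x in lborel. f (- x) = - f x"
  shows "integral\<^sup>L lborel f = 0"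
proof -
  have "integral\<^sup>L lborel f = (LINT x|lborel. f (- x))"
    using lborel_integral_real_affine[of "-1" f 0] by simp
  also have "\<dots> = (LINT x|lborel. - f x)"
    using f odd by (intro integral_cong_AE) auto
  finally show ?thesis by simp
qed


section \<open>The Lax--Phillips map\<close>

lemma L2_measurable: "f \<in> L2 \<Longrightarrow> f \<in> borel_measurable borel"
  by (simp add: L2_def)

lemma lax_phillips_map_L2: "lax_phillips_map \<psi> E U \<Longrightarrow> \<psi> v \<in> L2"
  by (simp add: lax_phillips_map_def)

lemma lax_phillips_map_sharp_fixed:
  assumes "lax_phillips_map \<psi> E U"
  shows "\<psi> v \<in> sharp_fixed L2"
proof -
  have "\<psi> v \<in> borel_measurable borel" by (intro L2_measurable lax_phillips_map_L2[OF assms])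
  then have "\<psi> v \<in> class_image \<psi> UNIV" by (auto simp: class_image_def)
  then show ?thesis using assms by (simp add: lax_phillips_map_def)
qed

lemma lax_phillips_map_onto:
  assumes "lax_phillips_map \<psi> E U" "g \<in> sharp_fixed L2"
  obtains v where "AE x in lborel. g x = \<psi> v x"
proof -
  have "g \<in> class_image \<psi> UNIV" using assms by (simp add: lax_phillips_map_def)
  then show ?thesis using that by (auto simp: class_image_def)
qed

text \<open>Frees the isometry property from the chosen representatives: any Borel functions in the
  classes of \<open>\<psi> v\<close> and \<open>\<psi> w\<close> may be used.\<close>

lemma lax_phillips_map_inner:
  fixes \<psi> :: "'e::real_inner \<Rightarrow> real \<Rightarrow> 'k::{real_inner,polish_space} complexification"
  assumes "lax_phillips_map \<psi> E U" "f \<in> borel_measurable borel" "g \<in> borel_measurable borel"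
    "AE x in lborel. f x = \<psi> v x" "AE x in lborel. g x = \<psi> w x"
  shows "inner v w = (LINT x|lborel. inner (f x) (g x))"
proof -
  have [measurable]: "\<psi> u \<in> borel_measurable borel" for u
    by (intro L2_measurable lax_phillips_map_L2[OF assms(1)])
  note [measurable] = assms(2,3)
  have "inner v w = (LINT x|lborel. inner (\<psi> v x) (\<psi> w x))"
    using assms(1) by (simp add: lax_phillips_map_def)
  also have "\<dots> = (LINT x|lborel. inner (f x) (g x))"
    by (intro integral_cong_AE) (use assms(4,5) in auto)
  finally show ?thesis .
qed

lemma borel_measurable_fst_snd:
  fixes f :: "'a \<Rightarrow> 'b::topological_space \<times> 'c::topological_space"
  assumes "f \<in> borel_measurable M"
  shows "(\<lambda>x. fst (f x)) \<in> borel_measurable M" "(\<lambda>x. snd (f x)) \<in> borel_measurable M"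
  by (rule measurable_compose[OF assms borel_measurable_continuous_onI];
      intro continuous_on_fst continuous_on_snd continuous_on_id)+

lemma cscale_measurable:
  fixes f :: "real \<Rightarrow> 'k::{real_inner,polish_space} complexification"
  assumes [measurable]: "f \<in> borel_measurable borel"
  shows "(\<lambda>x. cscale (cis (t * x)) (f x)) \<in> borel_measurable borel"
proof -
  note [measurable] = borel_measurable_fst_snd[OF assms]
  show ?thesis unfolding cscale_def by simp
qed

text \<open>Through this formula orthogonality to an orbit becomes a family of integral conditions
  indexed by the phase \<open>cis (t * x)\<close>.\<close>

lemma lax_phillips_map_inner_orbit:
  fixes \<psi> :: "'e::real_inner \<Rightarrow> real \<Rightarrow> 'k::{real_inner,polish_space} complexification"
  assumes "lax_phillips_map \<psi> E U" "f \<in> borel_measurable borel" "g \<in> borel_measurable borel"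
    "AE x in lborel. f x = \<psi> v x" "AE x in lborel. g x = \<psi> w x"
  shows "inner (U t v) w = (LINT x|lborel. inner (cscale (cis (t * x)) (f x)) (g x))"
proof (rule lax_phillips_map_inner[OF assms(1) _ assms(3) _ assms(5)])
  have "AE x in lborel. \<psi> (U t v) x = cscale (cis (t * x)) (\<psi> v x)"
    using assms(1) by (simp add: lax_phillips_map_def)
  with assms(4) show "AE x in lborel. cscale (cis (t * x)) (f x) = \<psi> (U t v) x"
    by eventually_elim simp
qed (rule cscale_measurable[OF assms(2)])

lemma lax_phillips_map_eq_0:
  fixes \<psi> :: "'e::real_inner \<Rightarrow> real \<Rightarrow> 'k::{real_inner,polish_space} complexification"
  assumes "lax_phillips_map \<psi> E U"
  shows "v = 0 \<longleftrightarrow> (AE x in lborel. \<psi> v x = 0)"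
proof -
  have L2: "\<psi> v \<in> L2" using assms by (rule lax_phillips_map_L2)
  have "v = 0 \<longleftrightarrow> inner v v = 0" by (rule inner_eq_zero_iff[symmetric])
  also have "inner v v = (LINT x|lborel. (norm (\<psi> v x))\<^sup>2)"
    using assms unfolding lax_phillips_map_def power2_norm_eq_inner by metis
  also have "\<dots> = 0 \<longleftrightarrow> (AE x in lborel. (norm (\<psi> v x))\<^sup>2 = 0)"
    using L2 by (intro integral_nonneg_eq_0_iff_AE) (auto simp: L2_def)
  finally show ?thesis by simp
qed

section \<open>Gaussian test functions\<close>

lemma integrable_std_normal_density_squared: "integrable lborel (\<lambda>x. (std_normal_density x)\<^sup>2)"
proof -
  have "\<bar>std_normal_density x\<bar> \<le> 1" for x
  proof -
    \<comment> \<open>The peak of the density is \<open>1 / sqrt (2 * pi)\<close>, at most 1, so the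
      square is dominated by the density itself.\<close>
    have "1 \<le> sqrt (2 * pi)" using pi_gt3 by (intro real_le_rsqrt) simp
    then have "std_normal_density x \<le> 1 * 1"
      unfolding std_normal_density_def by (intro mult_mono) auto
    then show ?thesis by simp
  qed
  then show ?thesis
    unfolding power2_eq_square by (intro integrable_bounded_mult) (auto simp: integrable_normal_density)
qed

text \<open>The function is real-valued (second component 0) and even, so both the conjugation and
  the reflection in \<open>sharp\<close> leave it unchanged.\<close>

lemma gaussian_sharp_fixed:
  fixes e :: "'k::{real_inner,polish_space}"
  shows "(\<lambda>x. (std_normal_density x *\<^sub>R e, 0)) \<in> sharp_fixed L2"
proof -
  have "integrable lborel (\<lambda>x. (std_normal_density x)\<^sup>2 * (norm e)\<^sup>2)"
    using integrable_std_normal_density_squared by simp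
  then have "(\<lambda>x. (std_normal_density x *\<^sub>R e, 0)) \<in> (L2 :: (real \<Rightarrow> 'k complexification) set)"
    by (simp add: L2_def norm_Pair power_mult_distrib)
  then show ?thesis
    by (simp add: sharp_fixed_def sharp_def cconj_def std_normal_density_def)
qed


section \<open>One-dimensional multiplicity\<close>

text \<open>The cyclic vector is the preimage of the Gaussian times \<open>e\<close>. If
  \<open>w\<close> is orthogonal to its orbit and \<open>\<psi> w = (g1 + i g2) e\<close>, parity
  splits orthogonality into separate conditions on \<open>g1\<close> and \<open>g2\<close>, and
  Fourier injectivity with positivity of the Gaussian kills both.\<close>

lemma R_cyclic_if_unit_generator:
  fixes \<psi> :: "'e::{real_inner,polish_space} \<Rightarrow> real \<Rightarrow> 'k::{real_inner,polish_space} complexification"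
    and e :: 'k
  assumes \<psi>: "lax_phillips_map \<psi> E U" and e: "inner e e = 1" "\<And>k. k = inner e k *\<^sub>R e"
  shows "R_cyclic U"
proof -
  let ?\<phi> = "std_normal_density"
  obtain v where v: "AE x in lborel. (?\<phi> x *\<^sub>R e, 0) = \<psi> v x"
    using lax_phillips_map_onto[OF \<psi> gaussian_sharp_fixed] .
  have "w = 0" if orth: "\<forall>s\<in>range (\<lambda>t. U t v). inner s w = 0" for w
  proof -
    define g1 where "g1 x = inner e (fst (\<psi> w x))" for x
    define g2 where "g2 x = inner e (snd (\<psi> w x))" for x
    have wS: "\<psi> w \<in> sharp_fixed L2" using lax_phillips_map_sharp_fixed[OF \<psi>] .
    then have [measurable]: "\<psi> w \<in> borel_measurable borel"
      and int: "integrable lborel (\<lambda>x. (norm (\<psi> w x))\<^sup>2)"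
      by (auto simp: sharp_fixed_def L2_def)
    note [measurable] = borel_measurable_fst_snd[OF \<open>\<psi> w \<in> borel_measurable borel\<close>]
    have [measurable]: "g1 \<in> borel_measurable borel" "g2 \<in> borel_measurable borel"
      unfolding g1_def[abs_def] g2_def[abs_def] by simp_all
    have \<psi>w: "\<psi> w x = (g1 x *\<^sub>R e, g2 x *\<^sub>R e)" for x
      by (simp add: g1_def g2_def prod_eq_iff flip: e(2))
    have nrm: "(norm (\<psi> w x))\<^sup>2 = (g1 x)\<^sup>2 + (g2 x)\<^sup>2" for x
      unfolding \<psi>w power2_norm_eq_inner using e(1) by (simp add: inner_Pair power2_eq_square)
    \<comment> \<open>Being \<open>sharp\<close>-fixed means that the real part is even and the
      imaginary part odd.\<close>
    have sym: "AE x in lborel. g1 (- x) = g1 x \<and> g2 (- x) = - g2 x"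
    proof -
      have "AE x in lborel. cconj (\<psi> w (- x)) = \<psi> w x"
        using wS by (simp add: sharp_fixed_def sharp_def)
      then show ?thesis
      proof eventually_elim
        case (elim x)
        from arg_cong[OF elim, of fst] arg_cong[OF elim, of "\<lambda>z. - snd z"]
        show ?case by (simp add: cconj_def g1_def g2_def)
      qed
    qed
    \<comment> \<open>A product of two square integrable functions is integrable, by
      \<open>2ab \<le> a^2 + b^2\<close>.\<close>
    have \<phi>g: "integrable lborel (\<lambda>x. ?\<phi> x * g x)"
      if "\<And>x. \<bar>g x\<bar> \<le> norm (\<psi> w x)" "g \<in> borel_measurable borel" for g
    proof (rule Bochner_Integration.integrable_bound)
      show "integrable lborel (\<lambda>x. (?\<phi> x)\<^sup>2 + (norm (\<psi> w x))\<^sup>2)"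
        using int integrable_std_normal_density_squared by (rule Bochner_Integration.integrable_add[rotated])
      show "AE x in lborel. norm (?\<phi> x * g x) \<le> norm ((?\<phi> x)\<^sup>2 + (norm (\<psi> w x))\<^sup>2)"
      proof (rule AE_I2)
        fix x
        have "\<bar>?\<phi> x * g x\<bar> \<le> ?\<phi> x * norm (\<psi> w x)"
          using that(1)[of x] by (simp add: abs_mult mult_left_mono)
        also have "\<dots> \<le> 2 * ?\<phi> x * norm (\<psi> w x)" by simp
        also have "\<dots> \<le> (?\<phi> x)\<^sup>2 + (norm (\<psi> w x))\<^sup>2" by (rule sum_squares_bound)
        finally show "norm (?\<phi> x * g x) \<le> norm ((?\<phi> x)\<^sup>2 + (norm (\<psi> w x))\<^sup>2)" by simp
      qed
    qed (use that in simp)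
    have bd: "\<bar>g1 x\<bar> \<le> norm (\<psi> w x)" "\<bar>g2 x\<bar> \<le> norm (\<psi> w x)" for x
      by (rule power2_le_imp_le; simp add: nrm)+
    have h: "integrable lborel (\<lambda>x. ?\<phi> x * g1 x)" "integrable lborel (\<lambda>x. ?\<phi> x * g2 x)"
      by (rule \<phi>g[OF bd(1)], measurable) (rule \<phi>g[OF bd(2)], measurable)
    have hc: "integrable lborel (\<lambda>x. cos (t * x) * (?\<phi> x * g1 x))"
      and hs: "integrable lborel (\<lambda>x. sin (t * x) * (?\<phi> x * g2 x))" for t
      by (intro integrable_bounded_mult h; simp)+
    have zero: "(LINT x|lborel. cos (t * x) * (?\<phi> x * g1 x))
        + (LINT x|lborel. sin (t * x) * (?\<phi> x * g2 x)) = 0" for t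
    proof -
      have "0 = inner (U t v) w" using orth by simp
      also have "\<dots> = (LINT x|lborel. inner (cscale (cis (t * x)) (?\<phi> x *\<^sub>R e, 0)) (\<psi> w x))"
        by (rule lax_phillips_map_inner_orbit[OF \<psi> _ _ v]) simp_all
      also have "\<dots> = (LINT x|lborel. cos (t * x) * (?\<phi> x * g1 x) + sin (t * x) * (?\<phi> x * g2 x))"
        by (simp add: cscale_def \<psi>w e(1) mult.commute mult.left_commute)
      also have "\<dots> = (LINT x|lborel. cos (t * x) * (?\<phi> x * g1 x))
          + (LINT x|lborel. sin (t * x) * (?\<phi> x * g2 x))"
        using hc hs by (rule Bochner_Integration.integral_add)
      finally show ?thesis by simp
    qed
    \<comment> \<open>The cosine term is even in \<open>t\<close> and the sine term odd, so
      comparing \<open>zero\<close> at \<open>t\<close> and \<open>- t\<close> makes each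
      vanish.\<close>
    have cos0: "(LINT x|lborel. cos (t * x) * (?\<phi> x * g1 x)) = 0"
      and sin0: "(LINT x|lborel. sin (t * x) * (?\<phi> x * g2 x)) = 0" for t
    proof -
      have "(LINT x|lborel. cos (- t * x) * (?\<phi> x * g1 x)) = (LINT x|lborel. cos (t * x) * (?\<phi> x * g1 x))"
        "(LINT x|lborel. sin (- t * x) * (?\<phi> x * g2 x)) = - (LINT x|lborel. sin (t * x) * (?\<phi> x * g2 x))"
        by (simp_all only: mult_minus_left cos_minus sin_minus Bochner_Integration.integral_minus)
      with zero[of t] zero[of "- t"]
      show "(LINT x|lborel. cos (t * x) * (?\<phi> x * g1 x)) = 0"
        "(LINT x|lborel. sin (t * x) * (?\<phi> x * g2 x)) = 0" by linarith+
    qed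
    have "AE x in lborel. ?\<phi> x * g1 x = 0"
    proof (rule fourier_injective[OF h(1) cos0])
      \<comment> \<open>The other half of the transform is free: the Gaussian times
        \<open>g1\<close> is even, so its sine transform has an odd integrand. For \<open>g2\<close>
        the roles of sine and cosine are exchanged.\<close>
      show "(LINT x|lborel. sin (t * x) * (?\<phi> x * g1 x)) = 0" for t
      proof (rule integral_odd)
        show "AE x in lborel. sin (t * - x) * (?\<phi> (- x) * g1 (- x)) = - (sin (t * x) * (?\<phi> x * g1 x))"
          using sym by eventually_elim (simp add: std_normal_density_def)
      qed simp
    qed
    moreover have "AE x in lborel. ?\<phi> x * g2 x = 0"
    proof (rule fourier_injective[OF h(2) _ sin0])
      show "(LINT x|lborel. cos (t * x) * (?\<phi> x * g2 x)) = 0" for t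
      proof (rule integral_odd)
        show "AE x in lborel. cos (t * - x) * (?\<phi> (- x) * g2 (- x)) = - (cos (t * x) * (?\<phi> x * g2 x))"
          using sym by eventually_elim (simp add: std_normal_density_def)
      qed simp
    qed
    ultimately have "AE x in lborel. \<psi> w x = 0"
    proof eventually_elim
      case (elim x)
      then have "g1 x = 0" "g2 x = 0" by (simp_all add: std_normal_density_def)
      then show ?case by (simp add: \<psi>w zero_prod_def)
    qed
    then show ?thesis by (rule lax_phillips_map_eq_0[OF \<psi>, THEN iffD2])
  qed
  then have "closure (span (range (\<lambda>t. U t v))) = UNIV"
    unfolding closure_span_eq_UNIV_iff by simp
  then show ?thesis unfolding R_cyclic_def by (rule exI)
qed

section \<open>Multiplicity at least two excludes cyclicity\<close>

text \<open>With respect to orthonormal vectors \<open>e1\<close>, \<open>e2\<close>, a vector with coordinates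
  \<open>(f\<^sub>1, f\<^sub>2)\<close> is orthogonal over the complex numbers to the one with coordinates
  \<open>(cnj f\<^sub>2, - cnj f\<^sub>1)\<close>.\<close>

definition quarter_turn :: "'k::real_inner \<Rightarrow> 'k \<Rightarrow> 'k complexification \<Rightarrow> 'k complexification" where
  "quarter_turn e1 e2 z =
     (inner e2 (fst z) *\<^sub>R e1 - inner e1 (fst z) *\<^sub>R e2,
      inner e1 (snd z) *\<^sub>R e2 - inner e2 (snd z) *\<^sub>R e1)"

text \<open>The conjugation in \<open>quarter_turn\<close> cancels that of the scalar product,
  leaving the real part of \<open>c * (f1 * f2 - f2 * f1)\<close> for the coordinates
  \<open>f1\<close>, \<open>f2\<close> of \<open>z\<close>. The arbitrary factor \<open>c\<close>
  lets one function be orthogonal to a whole orbit.\<close>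

lemma inner_cscale_quarter_turn: "inner (cscale c z) (quarter_turn e1 e2 z) = 0"
  by (simp add: cscale_def quarter_turn_def inner_Pair algebra_simps inner_commute)

text \<open>Pairing with \<open>e2\<close> recovers the \<open>e1\<close> coordinate of
  \<open>z\<close> up to sign and conjugation.\<close>

lemma quarter_turn_eq_0:
  assumes "inner e1 e1 = 1" "inner e2 e2 = 1" "inner e1 e2 = 0" "quarter_turn e1 e2 z = 0"
  shows "inner e1 (fst z) = 0" "inner e1 (snd z) = 0"
proof -
  have "inner e2 (fst (quarter_turn e1 e2 z)) = 0" "inner e2 (snd (quarter_turn e1 e2 z)) = 0"
    using assms(4) by simp_all
  then show "inner e1 (fst z) = 0" "inner e1 (snd z) = 0"
    using assms(1-3) by (simp_all add: quarter_turn_def inner_diff_right inner_commute)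
qed

text \<open>A crude bound that suffices for square integrability: each of the two components is a
  difference of two vectors of norm at most \<open>norm z\<close>.\<close>

lemma norm_quarter_turn_le:
  assumes "norm e1 = 1" "norm e2 = 1"
  shows "norm (quarter_turn e1 e2 z) \<le> 4 * norm z"
proof -
  have fst_le: "norm (fst z) \<le> norm z" and snd_le: "norm (snd z) \<le> norm z"
    using norm_fst_le[of "fst z" "snd z"] norm_snd_le[of "snd z" "fst z"] by simp_all
  have *: "\<bar>inner e u\<bar> \<le> norm z" if "norm e = 1" "norm u \<le> norm z" for e u
    using Cauchy_Schwarz_ineq2[of e u] that by simp
  have **: "norm (a *\<^sub>R x - b *\<^sub>R y) \<le> 2 * norm z"
    if "\<bar>a\<bar> \<le> norm z" "\<bar>b\<bar> \<le> norm z" "norm x = 1" "norm y = 1" for a b x y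
    using norm_triangle_ineq4[of "a *\<^sub>R x" "b *\<^sub>R y"] that by simp
  have "norm (fst (quarter_turn e1 e2 z)) \<le> 2 * norm z" "norm (snd (quarter_turn e1 e2 z)) \<le> 2 * norm z"
    unfolding quarter_turn_def fst_conv snd_conv
    by (intro ** * assms fst_le snd_le)+
  moreover have "norm (quarter_turn e1 e2 z) \<le>
      norm (fst (quarter_turn e1 e2 z)) + norm (snd (quarter_turn e1 e2 z))"
    using norm_Pair_le[of "fst (quarter_turn e1 e2 z)" "snd (quarter_turn e1 e2 z)"] by simp
  ultimately show ?thesis by linarith
qed

lemma quarter_turn_sharp_fixed:
  fixes f :: "real \<Rightarrow> 'k::{real_inner,polish_space} complexification"
  assumes e: "norm e1 = 1" "norm e2 = 1" and f: "f \<in> sharp_fixed L2"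
  shows "(\<lambda>x. quarter_turn e1 e2 (f x)) \<in> sharp_fixed L2"
proof -
  have fm [measurable]: "f \<in> borel_measurable borel"
    and int: "integrable lborel (\<lambda>x. (norm (f x))\<^sup>2)"
    and sh: "AE x in lborel. cconj (f (- x)) = f x"
    using f by (auto simp: sharp_fixed_def L2_def sharp_def)
  note [measurable] = borel_measurable_fst_snd[OF fm]
  have m [measurable]: "(\<lambda>x. quarter_turn e1 e2 (f x)) \<in> borel_measurable borel"
    unfolding quarter_turn_def by simp
  have "integrable lborel (\<lambda>x. (norm (quarter_turn e1 e2 (f x)))\<^sup>2)"
  proof (rule Bochner_Integration.integrable_bound)
    show "integrable lborel (\<lambda>x. 16 * (norm (f x))\<^sup>2)" using int by simp
    have "(norm (quarter_turn e1 e2 (f x)))\<^sup>2 \<le> (4 * norm (f x))\<^sup>2" for x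
      using norm_quarter_turn_le[OF e] by (intro power_mono) auto
    then show "AE x in lborel. norm ((norm (quarter_turn e1 e2 (f x)))\<^sup>2) \<le> norm (16 * (norm (f x))\<^sup>2)"
      by (simp add: power_mult_distrib)
  qed simp
  moreover have "AE x in lborel. cconj (quarter_turn e1 e2 (f (- x))) = quarter_turn e1 e2 (f x)"
    using sh
  proof eventually_elim
    case (elim x)
    \<comment> \<open>Both maps act separately and linearly on the real and imaginary components,
      and \<open>cconj\<close> only changes a sign, so they commute.\<close>
    have "cconj (quarter_turn e1 e2 (f (- x))) = quarter_turn e1 e2 (cconj (f (- x)))"
      by (simp add: cconj_def quarter_turn_def)
    with elim show ?case by simp
  qed
  ultimately show ?thesis using m by (simp add: sharp_fixed_def L2_def sharp_def)
qed

lemma gaussian_not_AE_0: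
  fixes e :: "'k::real_normed_vector"
  assumes "e \<noteq> 0"
  shows "\<not> (AE x in lborel. (std_normal_density x *\<^sub>R e, 0) = 0)"
proof
  assume "AE x in lborel. (std_normal_density x *\<^sub>R e, 0) = 0"
  then have "AE x::real in lborel. False"
    by eventually_elim (use assms in \<open>simp add: std_normal_density_def zero_prod_def\<close>)
  then have "ae_filter (lborel :: real measure) = bot" by (rule eventually_False[THEN iffD1])
  then show False unfolding ae_filter_eq_bot_iff by simp
qed

lemma R_cyclic_no_orthonormal_pair:
  fixes \<psi> :: "'e::{real_inner,polish_space} \<Rightarrow> real \<Rightarrow> 'k::{real_inner,polish_space} complexification"
    and e1 e2 :: 'k
  assumes \<psi>: "lax_phillips_map \<psi> E U" and cyc: "R_cyclic U"
    and e: "inner e1 e1 = 1" "inner e2 e2 = 1" "inner e1 e2 = 0"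
  shows False
proof -
  have ne: "norm e1 = 1" "norm e2 = 1" using e by (simp_all add: norm_eq_sqrt_inner)
  obtain v where v: "closure (span (range (\<lambda>t. U t v))) = UNIV" using cyc by (auto simp: R_cyclic_def)
  have total: "w = 0" if "\<And>t. inner (U t v) w = 0" for w
    by (rule closure_span_eq_UNIV_iff[THEN iffD1, OF v, rule_format]) (use that in auto)
  let ?f = "\<psi> v"
  have f: "?f \<in> sharp_fixed L2" using lax_phillips_map_sharp_fixed[OF \<psi>] .
  \<comment> \<open>Pointwise orthogonality to every phase multiple of \<open>?f\<close> makes the
    preimage of \<open>g\<close> orthogonal to the orbit of \<open>v\<close>, so cyclicity forces
    \<open>g\<close> to vanish.\<close>
  have orth0: "AE x in lborel. g x = 0"
    if g: "g \<in> sharp_fixed L2"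
      and o: "\<And>t. AE x in lborel. inner (cscale (cis (t * x)) (?f x)) (g x) = 0" for g
  proof -
    have [measurable]: "g \<in> borel_measurable borel" "?f \<in> borel_measurable borel"
      using f g by (auto simp: sharp_fixed_def L2_def)
    obtain w where w: "AE x in lborel. g x = \<psi> w x" using lax_phillips_map_onto[OF \<psi> g] .
    have "inner (U t v) w = 0" for t
    proof -
      have "inner (U t v) w = (LINT x|lborel. inner (cscale (cis (t * x)) (?f x)) (g x))"
        using w by (intro lax_phillips_map_inner_orbit[OF \<psi>]) auto
      also have "\<dots> = 0" using o[of t] by (rule integral_eq_zero_AE)
      finally show ?thesis .
    qed
    then have "AE x in lborel. \<psi> w x = 0"
      by (intro lax_phillips_map_eq_0[OF \<psi>, THEN iffD1] total)
    with w show ?thesis by eventually_elim simp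
  qed
  have "AE x in lborel. quarter_turn e1 e2 (?f x) = 0"
    using quarter_turn_sharp_fixed[OF ne f] by (rule orth0) (simp add: inner_cscale_quarter_turn)
  \<comment> \<open>The vanishing quarter turn leaves \<open>?f\<close> without \<open>e1\<close>
    component; the Gaussian along \<open>e1\<close> is then orthogonal to the orbit, yet
    nonzero.\<close>
  then have "AE x in lborel. inner (cscale (cis (t * x)) (?f x)) (std_normal_density x *\<^sub>R e1, 0) = 0" for t
  proof eventually_elim
    case (elim x)
    show ?case using quarter_turn_eq_0[OF e elim]
      by (simp add: cscale_def inner_diff_left inner_commute[of _ e1] inner_diff_right)
  qed
  then have "AE x in lborel. (std_normal_density x *\<^sub>R e1, 0) = (0 :: 'k complexification)"
    by (intro orth0 gaussian_sharp_fixed)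
  moreover have "e1 \<noteq> 0" using e(1) by auto
  ultimately show False by (rule gaussian_not_AE_0[THEN notE, rotated])
qed

section \<open>Both implications for a regular pair\<close>

theorem proposition6p20:
  fixes V :: "'h::{complex_inner,polish_space} set"
    and U :: "real \<Rightarrow> 'h \<Rightarrow> 'h"
  assumes "(UNIV :: 'h set) \<noteq> {0}"
    and "regular_pair V U"
    and "multiplicity_space TYPE('k::{real_inner,polish_space}) V U"
  shows "isomorphic_real_hilbert TYPE('k) TYPE(real) \<longleftrightarrow> R_cyclic U"
proof -
  obtain \<psi> :: "'h \<Rightarrow> real \<Rightarrow> 'k complexification" where \<psi>: "lax_phillips_map \<psi> V U"
    using assms(3) by (auto simp: multiplicity_space_def)
  show ?thesis
  proof
    assume "isomorphic_real_hilbert TYPE('k) TYPE(real)"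
    then obtain T :: "'k \<Rightarrow> real" where T: "linear T" "surj T" "\<And>x y. T x * T y = inner x y"
      by (auto simp: isomorphic_real_hilbert_def real_unitary_def)
    obtain e where e: "T e = 1" using T(2) by (metis surjD)
    \<comment> \<open>Since \<open>T\<close> is isometric and \<open>T e = 1\<close>,
      \<open>T k = inner e k\<close>; hence \<open>T\<close> kills the difference of the two
      sides.\<close>
    have gen: "k = inner e k *\<^sub>R e" for k
    proof -
      have "T (k - inner e k *\<^sub>R e) = 0"
        using T(1) e by (simp add: linear_diff linear_scale flip: T(3))
      then have "inner (k - inner e k *\<^sub>R e) (k - inner e k *\<^sub>R e) = 0" by (simp flip: T(3))
      then have "k - inner e k *\<^sub>R e = 0" by (rule inner_eq_zero_iff[THEN iffD1])
      then show ?thesis by (rule eq_iff_diff_eq_0[THEN iffD2])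
    qed
    have "inner e e = 1" using e by (simp flip: T(3))
    then show "R_cyclic U" using gen by (rule R_cyclic_if_unit_generator[OF \<psi>])
  next
    assume cyc: "R_cyclic U"
    obtain v :: 'h where "v \<noteq> 0" using assms(1) by blast
    \<comment> \<open>A zero multiplicity space would make every \<open>\<psi> v\<close> vanish,
      contradicting the nonzero vector \<open>v\<close>.\<close>
    have "\<exists>k::'k. k \<noteq> 0"
    proof (rule ccontr)
      assume "\<not> ?thesis"
      then have "\<psi> v x = 0" for x by (simp add: prod_eq_iff)
      with \<open>v \<noteq> 0\<close> show False using lax_phillips_map_eq_0[OF \<psi>] by simp
    qed
    then obtain k :: 'k where "k \<noteq> 0" ..
    define e where "e = sgn k"
    have e: "inner e e = 1"
      using \<open>k \<noteq> 0\<close> by (simp add: e_def norm_sgn flip: power2_norm_eq_inner)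
    \<comment> \<open>Otherwise the normalised component of \<open>x\<close> orthogonal to
      \<open>e\<close> completes \<open>e\<close> to an orthonormal pair, which cyclicity rules
      out.\<close>
    have span: "x = inner e x *\<^sub>R e" for x
    proof (rule ccontr)
      assume x: "x \<noteq> inner e x *\<^sub>R e"
      define y where "y = x - inner e x *\<^sub>R e"
      have y: "y \<noteq> 0" "inner e y = 0" using x e by (simp_all add: y_def inner_diff_right)
      have "inner (sgn y) (sgn y) = 1"
        using y(1) by (simp add: norm_sgn flip: power2_norm_eq_inner)
      moreover have "inner e (sgn y) = 0"
        unfolding sgn_div_norm using y(2) by simp
      ultimately show False by (rule R_cyclic_no_orthonormal_pair[OF \<psi> cyc e])
    qed
    have "real_unitary (inner e)"
      unfolding real_unitary_def
    proof (intro conjI allI)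
      show "linear (inner e)" by (intro bounded_linear.linear bounded_linear_inner_right)
      show "surj (inner e)" by (rule surjI[of _ "\<lambda>r. r *\<^sub>R e"]) (simp add: e)
      show "inner (inner e x) (inner e y) = inner x y" for x y
        using arg_cong[OF span[of x], of "\<lambda>z. inner z y"] by simp
    qed
    then show "isomorphic_real_hilbert TYPE('k) TYPE(real)"
      by (auto simp: isomorphic_real_hilbert_def)
  qed
qed

end
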